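(* Let $\Gamma_0,\Gamma_1,\Gamma_2,\Gamma_3$ be Hermitian $4\times 4$ complex matrices with $\Gamma_j^2=\mathbb{I}$ and $\Gamma_j\Gamma_k=-\Gamma_k\Gamma_j$ for $j\ne k$, and let $\Gamma_4=\Gamma_0\Gamma_1\Gamma_2\Gamma_3$. Let $\mathcal{B}_0,\mathcal{B}_1,\mathcal{B}_2$ be the common orthonormal eigenbases of the three classes of commuting operators $$\mathcal{C}_{0} = \{\Gamma_{0}, i\Gamma_{1}\Gamma_{4}, i\Gamma_{3}\Gamma_{2} \},\quad \mathcal{C}_{1} = \{\Gamma_{1}, i\Gamma_{2}\Gamma_{4}, i\Gamma_{3}\Gamma_{0} \},\quad \mathcal{C}_{2} = \{\Gamma_{2}, i\Gamma_{0}\Gamma_{4}, i\Gamma_{3}\Gamma_{1} \},$$ and let $U$ be a unitary such that conjugation $X\mapsto UXU^\dagger$ maps $\Gamma_0\mapsto\Gamma_1\mapsto\Gamma_2\mapsto\Gamma_0$ and fixes $\Gamma_3$ and $\Gamma_4$. Then the minimum over unit vectors $|\psi\rangle\in\mathbb{C}^4$ of $$\frac13\sum_{j=0}^{2}H_2(\mathcal{B}_j\,|\,|\psi\rangle)$$ is attained at a common eigenvector of the commuting operators $\Gamma_0$, $i\Gamma_2\Gamma_4$ and $i\Gamma_3\Gamma_1$, and it is not attained at any eigenvector of $U$.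
   Context: For an orthonormal basis $\mathcal{B}=\{|b\rangle\}_b$ and a unit vector $|\psi\rangle$, the collision entropy is $H_2(\mathcal{B}\,|\,|\psi\rangle) = -\log \sum_{b} |\langle b|\psi\rangle|^4$. Logarithms are base 2. The common eigenbasis of each class is unique up to phases and ordering of its elements. *)

theory Defs
  imports "HOL-Analysis.Analysis"
begin

(* HOL-Analysis has only the real inner product on complex ^ 'n; this is the sesquilinear one,
   conjugate-linear in its first argument. *)
definition braket :: "complex ^ 'n \<Rightarrow> complex ^ 'n \<Rightarrow> complex" where
  "braket u v = (\<Sum>i\<in>UNIV. cnj (u $ i) * v $ i)"

definition dagger :: "complex ^ 'n ^ 'm \<Rightarrow> complex ^ 'm ^ 'n" where
  "dagger A = map_matrix cnj (transpose A)"

definition hermitian :: "complex ^ 'n ^ 'n \<Rightarrow> bool" where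
  "hermitian A \<longleftrightarrow> dagger A = A"

definition unitary :: "complex ^ 'n ^ 'n \<Rightarrow> bool" where
  "unitary U \<longleftrightarrow> U ** dagger U = mat 1 \<and> dagger U ** U = mat 1"

(* The library's *s scales a vector and * *\<^sub>R has real scalars only. *)
definition mat_scale :: "complex \<Rightarrow> complex ^ 'n ^ 'm \<Rightarrow> complex ^ 'n ^ 'm" where
  "mat_scale c A = map_matrix (\<lambda>x. c * x) A"

definition eigenvector :: "complex ^ 'n ^ 'n \<Rightarrow> complex ^ 'n \<Rightarrow> bool" where
  "eigenvector A v \<longleftrightarrow> v \<noteq> 0 \<and> (\<exists>c. A *v v = c *s v)"

(* vec.span is the span over the complex scalars; plain span would be the real span. *)
definition orthonormal_basis :: "(complex ^ 'n) set \<Rightarrow> bool" where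
  "orthonormal_basis B \<longleftrightarrow>
     (\<forall>u\<in>B. \<forall>v\<in>B. braket u v = (if u = v then 1 else 0)) \<and> vec.span B = UNIV"

definition common_eigenbasis ::
  "(complex ^ 'n ^ 'n) set \<Rightarrow> (complex ^ 'n) set \<Rightarrow> bool" where
  "common_eigenbasis C B \<longleftrightarrow>
     orthonormal_basis B \<and> (\<forall>A\<in>C. \<forall>b\<in>B. eigenvector A b)"

definition collision_entropy :: "(complex ^ 'n) set \<Rightarrow> complex ^ 'n \<Rightarrow> real" where
  "collision_entropy B \<psi> = - log 2 (\<Sum>b\<in>B. cmod (braket b \<psi>) ^ 4)"

end

(* For a class {A, A', A A'} with common eigenbasis B, the collision probability of a unit vector is
   (1 + <A>^2 + <A'>^2 + <A A'>^2) / 4.  The nine operators of the three classes split into three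
   triples of mutually anticommuting involutions, and by Bessel's inequality the squared expectations
   in such a triple add up to at most 1.  Hence the three collision probabilities sum to at most 3/2,
   and convexity of - log 2 gives average entropy at least 1.  The eigenvector in the theorem takes one
   operator out of each class to an expectation of modulus 1, so every collision probability is at
   least 1/2 there.  At an eigenvector of U the expectations are constant within each triple; the sums
   over the triples are again anticommuting, with square 3, so the nine squares add up to at most 1
   and the average entropy exceeds 1. *)
theory Submission
  imports Defs
begin

section \<open>Bessel's inequality for anticommuting Hermitian operators\<close>

text \<open>The common squared length \<open>k\<close> stays a parameter because both unit triples
  and triples with \<open>k = 3\<close> are needed later.\<close>

lemma Bessel_three:
  fixes p x y z :: "'a :: real_inner"
  assumes "x \<bullet> x = k" "y \<bullet> y = k" "z \<bullet> z = k" "x \<bullet> y = 0" "x \<bullet> z = 0" "y \<bullet> z = 0"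
  shows "(p \<bullet> x)\<^sup>2 + (p \<bullet> y)\<^sup>2 + (p \<bullet> z)\<^sup>2 \<le> k * (p \<bullet> p)"
proof (cases "k = 0")
  case True
  then show ?thesis using assms by simp
next
  case False
  then have "k > 0" using assms(1) inner_ge_zero[of x] by linarith
  \<comment> \<open>For \<open>k > 0\<close>, \<open>q\<close> is \<open>k\<close> times the
    component of \<open>p\<close> orthogonal to \<open>x\<close>, \<open>y\<close>,
    \<open>z\<close>; the inequality is the nonnegativity of its squared length.\<close>
  define q where "q = k *\<^sub>R p - (p \<bullet> x) *\<^sub>R x - (p \<bullet> y) *\<^sub>R y - (p \<bullet> z) *\<^sub>R z"
  have "q \<bullet> q = k * (k * (p \<bullet> p) - ((p \<bullet> x)\<^sup>2 + (p \<bullet> y)\<^sup>2 + (p \<bullet> z)\<^sup>2))"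
    using assms unfolding q_def
    by (simp add: inner_diff_left inner_diff_right inner_commute algebra_simps power2_eq_square)
  with inner_ge_zero[of q] \<open>k > 0\<close> show ?thesis
    by (simp add: zero_le_mult_iff)
qed

lemma inner_eq_Re_braket: "u \<bullet> v = Re (braket u v)"
  by (simp add: braket_def inner_vec_def inner_complex_def)

lemma dagger_nth: "dagger A $ i $ j = cnj (A $ j $ i)"
  by (simp add: dagger_def map_matrix_def transpose_def)

lemma braket_dagger: "braket (A *v u) v = braket u (dagger A *v v)"
proof -
  have "braket (A *v u) v = (\<Sum>i\<in>UNIV. \<Sum>j\<in>UNIV. cnj (A $ i $ j) * cnj (u $ j) * v $ i)"
    by (simp add: braket_def matrix_vector_mult_def sum_distrib_right)
  also have "\<dots> = braket u (dagger A *v v)"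
    unfolding braket_def matrix_vector_mult_def
    by (subst sum.swap) (simp add: dagger_nth sum_distrib_left mult_ac)
  finally show ?thesis .
qed

lemma braket_hermitian: "hermitian A \<Longrightarrow> braket (A *v u) v = braket u (A *v v)"
  by (simp add: braket_dagger hermitian_def)

lemma inner_hermitian: "hermitian A \<Longrightarrow> (A *v u) \<bullet> v = u \<bullet> (A *v v)"
  by (simp add: inner_eq_Re_braket braket_hermitian)

text \<open>Moving both operators across turns the product into minus itself with swapped arguments,
  and the real inner product is symmetric. The complex \<open>braket\<close> of these vectors need
  not vanish; it is only purely imaginary.\<close>

lemma inner_anticommuting:
  assumes "hermitian X" "hermitian Y" "\<And>v. X *v (Y *v v) = - (Y *v (X *v v))"
  shows "(X *v v) \<bullet> (Y *v v) = 0"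
proof -
  have "(X *v v) \<bullet> (Y *v v) = v \<bullet> (X *v (Y *v v))"
    by (rule inner_hermitian[OF assms(1)])
  also have "\<dots> = - (v \<bullet> (Y *v (X *v v)))"
    by (simp add: assms(3))
  also have "v \<bullet> (Y *v (X *v v)) = (Y *v v) \<bullet> (X *v v)"
    by (rule inner_hermitian[OF assms(2), symmetric])
  finally show ?thesis by (simp add: inner_commute)
qed

text \<open>The real inner product is the real part of \<open>braket\<close>. For Hermitian
  \<open>A\<close> the value of \<open>braket\<close> is already real, so this is the usual quantum
  expectation.\<close>

definition expect :: "complex ^ 'n ^ 'n \<Rightarrow> complex ^ 'n \<Rightarrow> real" where
  "expect A \<psi> = \<psi> \<bullet> (A *v \<psi>)"

text \<open>The images of \<open>\<psi>\<close> under the three operators are orthogonal and have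
  squared length \<open>k\<close>, so Bessel's inequality applies with \<open>\<psi>\<close> as the
  projected vector.\<close>

lemma expect_anticommuting_triple:
  assumes herm: "hermitian X" "hermitian Y" "hermitian Z"
    and square: "\<And>v. X *v (X *v v) = k *\<^sub>R v" "\<And>v. Y *v (Y *v v) = k *\<^sub>R v"
      "\<And>v. Z *v (Z *v v) = k *\<^sub>R v"
    and anticomm: "\<And>v. X *v (Y *v v) = - (Y *v (X *v v))" "\<And>v. X *v (Z *v v) = - (Z *v (X *v v))"
      "\<And>v. Y *v (Z *v v) = - (Z *v (Y *v v))"
    and norm: "norm \<psi> = 1"
  shows "(expect X \<psi>)\<^sup>2 + (expect Y \<psi>)\<^sup>2 + (expect Z \<psi>)\<^sup>2 \<le> k"
proof -
  have unit: "\<psi> \<bullet> \<psi> = 1" using norm by (simp add: dot_square_norm)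
  have norms: "(M *v \<psi>) \<bullet> (M *v \<psi>) = k" if "hermitian M" "\<And>v. M *v (M *v v) = k *\<^sub>R v" for M
    by (simp add: inner_hermitian[OF that(1)] that(2) unit)
  show ?thesis
    using Bessel_three[where p = \<psi>, OF norms[OF herm(1) square(1)] norms[OF herm(2) square(2)]
        norms[OF herm(3) square(3)] inner_anticommuting[OF herm(1,2) anticomm(1)]
        inner_anticommuting[OF herm(1,3) anticomm(2)] inner_anticommuting[OF herm(2,3) anticomm(3)]]
    by (simp add: expect_def unit)
qed

section \<open>Sesquilinear algebra, orthonormal bases and traces\<close>

lemma braket_smult:
  "braket (c *s u) w = cnj c * braket u w"
  "braket u (c *s w) = c * braket u w"
  by (simp_all add: braket_def algebra_simps sum.distrib sum_distrib_left)

lemma braket_sum_right: "braket u (\<Sum>b\<in>S. f b) = (\<Sum>b\<in>S. braket u (f b))"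
  by (simp add: braket_def sum_distrib_left sum.swap[of _ S])

lemma cnj_braket: "cnj (braket u v) = braket v u"
  by (simp add: braket_def mult.commute)

lemma hermitian_add: "hermitian A \<Longrightarrow> hermitian B \<Longrightarrow> hermitian (A + B)"
  by (simp add: hermitian_def dagger_def map_matrix_def transpose_def vec_eq_iff)

lemma dagger_mult: "dagger (A ** B) = dagger B ** dagger A"
  by (simp add: dagger_def map_matrix_def transpose_def matrix_matrix_mult_def vec_eq_iff mult.commute)

lemma mat_scale_mult_vector: "mat_scale c A *v v = c *s (A *v v)"
  by (simp add: mat_scale_def map_matrix_def matrix_vector_mult_def vec_eq_iff sum_distrib_left mult_ac)

lemma hermitian_i_mult_anticommuting:
  assumes "hermitian A" "hermitian B" "A ** B = - (B ** A)"
  shows "hermitian (mat_scale \<i> (A ** B))"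
proof -
  have "dagger (mat_scale \<i> (A ** B)) = mat_scale (- \<i>) (dagger (A ** B))"
    by (simp add: dagger_def mat_scale_def map_matrix_def transpose_def vec_eq_iff)
  also have "dagger (A ** B) = B ** A"
    using assms(1,2) by (simp add: dagger_mult hermitian_def)
  also have "B ** A = - (A ** B)"
    by (simp add: assms(3))
  also have "mat_scale (- \<i>) (- (A ** B)) = mat_scale \<i> (A ** B)"
    by (simp add: mat_scale_def map_matrix_def vec_eq_iff)
  finally show ?thesis by (simp add: hermitian_def)
qed

text \<open>Finiteness is not part of the definition of a basis. It follows because orthogonal
  nonzero vectors are independent already over the reals.\<close>

lemma orthonormal_basis_expansion:
  fixes B :: "(complex ^ 'n) set"
  assumes "orthonormal_basis B"
  shows "finite B" "v = (\<Sum>b\<in>B. braket b v *s b)"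
proof -
  have on: "braket u v = (if u = v then 1 else 0)" if "u \<in> B" "v \<in> B" for u v
    using assms that by (simp add: orthonormal_basis_def)
  have "pairwise orthogonal B"
    by (auto simp: pairwise_def orthogonal_def inner_eq_Re_braket on)
  moreover have "0 \<notin> B" using on[of 0 0] by (auto simp: braket_def)
  ultimately show fin: "finite B"
    using pairwise_orthogonal_independent independent_imp_finite by blast
  have "v \<in> vec.span B" using assms by (simp add: orthonormal_basis_def)
  then obtain c where c: "v = (\<Sum>b\<in>B. c b *s b)"
    using vec.span_finite[OF fin] by auto
  have "braket b v = c b" if "b \<in> B" for b
  proof -
    have "braket b v = (\<Sum>d\<in>B. c d * braket b d)"
      unfolding c braket_sum_right braket_smult ..
    also have "\<dots> = (\<Sum>d\<in>B. if d = b then c d else 0)"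
      using that by (intro sum.cong) (auto simp: on)
    finally show ?thesis using that fin by simp
  qed
  then show "v = (\<Sum>b\<in>B. braket b v *s b)" using c by simp
qed

lemma braket_parseval:
  assumes "orthonormal_basis B"
  shows "braket u v = (\<Sum>b\<in>B. braket u b * braket b v)"
proof -
  have "braket u v = braket u (\<Sum>b\<in>B. braket b v *s b)"
    using orthonormal_basis_expansion(2)[OF assms] by metis
  then show ?thesis by (simp add: braket_sum_right braket_smult mult.commute)
qed

lemma trace_eq_sum_braket:
  assumes "orthonormal_basis B"
  shows "trace A = (\<Sum>b\<in>B. braket b (A *v b))"
proof -
  \<comment> \<open>The completeness relation, obtained as Parseval's identity for two coordinate
    vectors.\<close>
  have delta: "(\<Sum>b\<in>B. b $ j * cnj (b $ i)) = (if i = j then 1 else 0)" for i j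
  proof -
    have ax: "braket (axis k 1) b = b $ k" "braket b (axis k 1) = cnj (b $ k)" for k and b :: "complex ^ 'a"
      by (simp_all add: braket_def axis_def if_distrib[of cnj] if_distrib[of "\<lambda>x. x * _"]
            if_distrib[of "\<lambda>x. _ * x"] cong: if_cong)
    show ?thesis
      using braket_parseval[OF assms, of "axis j 1" "axis i 1"]
      unfolding ax by (auto simp: axis_def)
  qed
  have "(\<Sum>b\<in>B. braket b (A *v b)) = (\<Sum>i\<in>UNIV. \<Sum>j\<in>UNIV. A $ i $ j * (\<Sum>b\<in>B. b $ j * cnj (b $ i)))"
    unfolding braket_def matrix_vector_mult_def
    by (simp add: sum_distrib_left sum.swap[of _ B] mult_ac)
  also have "\<dots> = trace A"
    unfolding delta trace_def by (simp add: if_distrib cong: if_cong)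
  finally show ?thesis ..
qed

text \<open>By cyclicity, inserting \<open>X ** X\<close> and moving one \<open>X\<close> past
  \<open>A\<close> gives the trace of \<open>A\<close> with the opposite sign.\<close>

lemma trace_anticommuting:
  fixes A X :: "complex ^ 'n ^ 'n"
  assumes "A ** X = - (X ** A)" "X ** X = mat 1"
  shows "trace A = 0"
proof -
  have "trace A = trace ((A ** X) ** X)"
    by (simp add: assms(2) matrix_mul_assoc[symmetric])
  also have "\<dots> = trace (- (X ** A) ** X)" by (simp only: assms)
  also have "\<dots> = - trace ((X ** A) ** X)"
    by (simp add: trace_def matrix_matrix_mult_def sum_negf)
  also have "trace ((X ** A) ** X) = trace A"
    by (simp add: trace_mul_sym[of _ X] matrix_mul_assoc assms)
  finally show ?thesis by simp
qed

section \<open>Expectations and collision probability in a common eigenbasis\<close>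

text \<open>The eigenvalue squares to 1, hence is real and equals the expectation. So
  \<open>expect A\<close> can serve as the function that assigns signs to basis vectors.\<close>

lemma involution_eigenvector:
  assumes "eigenvector A b" "A ** A = mat 1" "braket b b = 1"
  shows "A *v b = of_real (expect A b) *s b" "(expect A b)\<^sup>2 = 1"
proof -
  obtain c where c: "b \<noteq> 0" "A *v b = c *s b" using assms(1) by (auto simp: eigenvector_def)
  have "(c * c) *s b = A *v (A *v b)"
    by (simp add: c vector_scalar_commute vector_smult_assoc)
  also have "\<dots> = b" by (simp add: matrix_vector_mul_assoc assms)
  finally have "(c * c - 1) *s b = 0" by (simp add: vec_eq_iff algebra_simps)
  then have "c * c = 1" using c(1) vector_mul_eq_0[of "c * c - 1" b] by simp
  then have "c = 1 \<or> c = -1" by (simp add: square_eq_1_iff)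
  moreover have "expect A b = Re c"
    by (simp add: expect_def c inner_eq_Re_braket braket_smult assms)
  ultimately show "A *v b = of_real (expect A b) *s b" "(expect A b)\<^sup>2 = 1"
    by (auto simp: c)
qed

lemma expect_eq_sum_eigenbasis:
  assumes "orthonormal_basis B" "hermitian A" "\<And>b. b \<in> B \<Longrightarrow> A *v b = of_real (s b) *s b"
  shows "expect A \<psi> = (\<Sum>b\<in>B. s b * cmod (braket b \<psi>) ^ 2)"
proof -
  have "braket \<psi> (A *v \<psi>) = (\<Sum>b\<in>B. braket \<psi> b * braket (A *v b) \<psi>)"
    by (subst braket_parseval[OF assms(1)]) (simp add: braket_hermitian[OF assms(2)])
  also have "\<dots> = (\<Sum>b\<in>B. of_real (s b * cmod (braket b \<psi>) ^ 2))"
  proof (rule sum.cong[OF refl])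
    fix b assume "b \<in> B"
    have "braket \<psi> b * braket b \<psi> = of_real (cmod (braket b \<psi>) ^ 2)"
      unfolding complex_norm_square cnj_braket by (rule mult.commute)
    then show "braket \<psi> b * braket (A *v b) \<psi> = of_real (s b * cmod (braket b \<psi>) ^ 2)"
      using assms(3)[OF \<open>b \<in> B\<close>] by (simp add: braket_smult algebra_simps)
  qed
  finally show ?thesis
    by (simp add: expect_def inner_eq_Re_braket)
qed

lemma trace_eq_sum_eigenbasis:
  assumes "orthonormal_basis B" "\<And>b. b \<in> B \<Longrightarrow> A *v b = of_real (s b) *s b"
  shows "trace A = of_real (\<Sum>b\<in>B. s b)"
proof -
  have "braket b b = 1" if "b \<in> B" for b
    using assms(1) that by (simp add: orthonormal_basis_def)
  then show ?thesis
    by (simp add: trace_eq_sum_braket[OF assms(1)] assms(2) braket_smult)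
qed

lemma sum_eigenvalues_traceless:
  assumes "orthonormal_basis B" "\<And>b. b \<in> B \<Longrightarrow> A *v b = of_real (s b) *s b" "trace A = 0"
  shows "sum s B = 0"
proof -
  have "of_real (sum s B) = (0 :: complex)"
    by (rule trans[OF trace_eq_sum_eigenbasis[OF assms(1,2), symmetric] assms(3)])
  then show ?thesis by (simp only: of_real_eq_0_iff)
qed

lemma one_plus_mult_signs_nonneg: "x\<^sup>2 = 1 \<Longrightarrow> y\<^sup>2 = 1 \<Longrightarrow> 0 \<le> 1 + x * (y :: real)"
  using zero_le_power2[of "x + y"] by (simp add: power2_sum)

text \<open>The sign pairs label the four basis vectors uniquely, so the projector onto
  \<open>b\<close> is \<open>(1 + s b A) (1 + t b A') / 4\<close>. The probabilities and the four
  expectations (that of the identity being 1) are therefore Hadamard transforms of each other, and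
  the claim is Parseval's identity for this transform.\<close>

lemma collision_probability_eq_expect:
  fixes A A' :: "complex ^ 4 ^ 4"
  assumes basis: "common_eigenbasis {A, A', C} B"
    and herm: "hermitian A" "hermitian A'" "hermitian C"
    and invol: "A ** A = mat 1" "A' ** A' = mat 1"
    and prod: "A ** A' = C"
    and trace: "trace A = 0" "trace A' = 0" "trace C = 0"
    and norm: "norm \<psi> = 1"
  shows "(\<Sum>b\<in>B. cmod (braket b \<psi>) ^ 4)
    = (1 + (expect A \<psi>)\<^sup>2 + (expect A' \<psi>)\<^sup>2 + (expect C \<psi>)\<^sup>2) / 4"
proof -
  have B: "orthonormal_basis B" using basis by (simp add: common_eigenbasis_def)
  then have fin: "finite B" by (rule orthonormal_basis_expansion)
  define s where "s = expect A"
  define t where "t = expect A'"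
  define p where "p b = cmod (braket b \<psi>) ^ 2" for b
  have eig: "eigenvector A b" "eigenvector A' b" "braket b b = 1" if "b \<in> B" for b
    using that basis B by (simp_all add: common_eigenbasis_def orthonormal_basis_def)
  have st: "A *v b = of_real (s b) *s b" "(s b)\<^sup>2 = 1" "A' *v b = of_real (t b) *s b" "(t b)\<^sup>2 = 1"
    if "b \<in> B" for b
    unfolding s_def t_def
    by (rule involution_eigenvector[OF eig(1)[OF that] invol(1) eig(3)[OF that]]
        involution_eigenvector[OF eig(2)[OF that] invol(2) eig(3)[OF that]])+
  have stC: "C *v b = of_real (s b * t b) *s b" if "b \<in> B" for b
  proof -
    have "C *v b = A *v (A' *v b)" by (simp add: matrix_vector_mul_assoc prod)
    then show ?thesis
      by (simp add: st[OF that] vector_scalar_commute vector_smult_assoc mult.commute)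
  qed
  \<comment> \<open>The identity, with all eigenvalues 1, yields both the total probability (its
    expectation) and the number of basis vectors (its trace).\<close>
  have id: "mat 1 *v b = of_real 1 *s b" for b :: "complex ^ 4" by simp
  have "hermitian (mat 1 :: complex ^ 4 ^ 4)"
    by (auto simp: hermitian_def dagger_def map_matrix_def transpose_def vec_eq_iff mat_def)
  moreover have "expect (mat 1) \<psi> = 1" using norm by (simp add: expect_def dot_square_norm)
  ultimately have p1: "(\<Sum>b\<in>B. p b) = 1"
    using expect_eq_sum_eigenbasis[OF B, of "mat 1" "\<lambda>_. 1" \<psi>] by (simp add: p_def)
  have expect_sums: "expect A \<psi> = (\<Sum>b\<in>B. s b * p b)" "expect A' \<psi> = (\<Sum>b\<in>B. t b * p b)"
    "expect C \<psi> = (\<Sum>b\<in>B. s b * t b * p b)"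
    unfolding p_def
    using expect_eq_sum_eigenbasis[OF B herm(1) st(1)] expect_eq_sum_eigenbasis[OF B herm(2) st(3)]
      expect_eq_sum_eigenbasis[OF B herm(3) stC] by blast+
  have card: "(\<Sum>b\<in>B. 1) = (4 :: real)"
  proof -
    have "of_real (\<Sum>b\<in>B. 1) = (of_real 4 :: complex)"
      unfolding trace_eq_sum_eigenbasis[OF B id, symmetric] by (simp add: trace_I)
    then show ?thesis by (simp only: of_real_eq_iff)
  qed
  note sums = sum_eigenvalues_traceless[OF B st(1) trace(1)] sum_eigenvalues_traceless[OF B st(3) trace(2)]
    sum_eigenvalues_traceless[OF B stC trace(3)]
  \<comment> \<open>The inverse transform: the left side is the expectation of four times the
    projector onto \<open>b\<close>.\<close>
  have four: "1 + s b * expect A \<psi> + t b * expect A' \<psi> + s b * t b * expect C \<psi> = 4 * p b"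
    if b: "b \<in> B" for b
  proof -
    define k where "k d = (1 + s b * s d) * (1 + t b * t d)" for d
    \<comment> \<open>\<open>k d\<close> is 0 or 4; by tracelessness its sum is 4 = \<open>k b\<close>, so \<open>b\<close> is determined by its signs.\<close>
    have "sum k B = (\<Sum>d\<in>B. 1) + s b * sum s B + t b * sum t B + s b * t b * (\<Sum>d\<in>B. s d * t d)"
      by (simp add: k_def algebra_simps sum.distrib sum_distrib_left)
    then have "sum k B = 4" by (simp add: card[simplified] sums)
    moreover have kb: "k b = 4" using st[OF b] by (simp add: k_def power2_eq_square)
    ultimately have "sum k (B - {b}) = 0" using b fin by (simp add: sum_diff1)
    moreover have "k d \<ge> 0" if "d \<in> B" for d
      unfolding k_def using st[OF b] st[OF that] by (intro mult_nonneg_nonneg one_plus_mult_signs_nonneg)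
    ultimately have k0: "k d = 0" if "d \<in> B" "d \<noteq> b" for d
      using that fin by (subst (asm) sum_nonneg_eq_0_iff) auto
    have "1 + s b * expect A \<psi> + t b * expect A' \<psi> + s b * t b * expect C \<psi>
        = (\<Sum>d\<in>B. p d) + s b * expect A \<psi> + t b * expect A' \<psi> + s b * t b * expect C \<psi>"
      by (simp add: p1)
    also have "\<dots> = (\<Sum>d\<in>B. k d * p d)"
      unfolding expect_sums k_def
      by (simp add: algebra_simps sum.distrib sum_distrib_left)
    also have "\<dots> = (\<Sum>d\<in>B. if d = b then 4 * p d else 0)"
      by (rule sum.cong) (auto simp: k0 kb)
    finally show ?thesis using b fin by simp
  qed
  \<comment> \<open>One factor \<open>p b\<close> is replaced by its inverse transform; summing the
    other against the signs restores the expectations.\<close>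
  have "4 * (\<Sum>b\<in>B. cmod (braket b \<psi>) ^ 4) = (\<Sum>b\<in>B. p b * (4 * p b))"
    by (simp add: p_def sum_distrib_left power4_eq_xxxx power2_eq_square mult_ac)
  also have "\<dots> = (\<Sum>b\<in>B. p b * (1 + s b * expect A \<psi> + t b * expect A' \<psi> + s b * t b * expect C \<psi>))"
    by (simp add: four)
  also have "\<dots> = (\<Sum>b\<in>B. p b) + expect A \<psi> * (\<Sum>b\<in>B. s b * p b) + expect A' \<psi> * (\<Sum>b\<in>B. t b * p b)
      + expect C \<psi> * (\<Sum>b\<in>B. s b * t b * p b)"
    by (simp add: algebra_simps sum.distrib sum_distrib_left)
  also have "\<dots> = 1 + (expect A \<psi>)\<^sup>2 + (expect A' \<psi>)\<^sup>2 + (expect C \<psi>)\<^sup>2"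
    unfolding p1 expect_sums[symmetric] by (simp add: power2_eq_square)
  finally show ?thesis by simp
qed

text \<open>The tangent bound of \<open>- log 2\<close> at \<open>1 / 2\<close>, summed.\<close>
lemma sum_neg_log_ge:
  fixes p :: "'a \<Rightarrow> real"
  assumes "\<And>j. j \<in> J \<Longrightarrow> p j > 0"
  shows "(\<Sum>j\<in>J. - log 2 (p j)) \<ge> card J - (2 * sum p J - card J) / ln 2"
proof -
  have "- log 2 (p j) \<ge> 1 - (2 * p j - 1) / ln 2" if "j \<in> J" for j
  proof -
    have "ln (2 * p j) \<le> 2 * p j - 1" using assms[OF that] by (intro ln_le_minus_one) simp
    then have "ln 2 + ln (p j) \<le> 2 * p j - 1" using assms[OF that] by (simp add: ln_mult)
    then have "(ln 2 + ln (p j)) / ln 2 \<le> (2 * p j - 1) / ln 2" by (rule divide_right_mono) simp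
    then show ?thesis by (simp add: log_def add_divide_distrib)
  qed
  then have "(\<Sum>j\<in>J. 1 - (2 * p j - 1) / ln 2) \<le> (\<Sum>j\<in>J. - log 2 (p j))"
    by (rule sum_mono)
  then show ?thesis
    by (simp add: sum_subtractf sum_distrib_left flip: sum_divide_distrib)
qed

section \<open>Joint eigenvectors of commuting involutions\<close>

lemma expect_add: "expect (A + B) \<psi> = expect A \<psi> + expect B \<psi>"
  by (simp add: expect_def matrix_vector_mult_add_rdistrib inner_add_right)

lemma matrix_vector_mult_minus:
  "(A :: complex ^ 'n ^ 'm) *v (- v) = - (A *v v)" "(- A) *v v = - (A *v v)"
  by (simp_all add: matrix_vector_mult_def vec_eq_iff sum_negf)

lemma matrix_vector_mult_complex_scaleR: "(A :: complex ^ 'n ^ 'm) *v (r *\<^sub>R v) = r *\<^sub>R (A *v v)"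
  by (rule linear_cmul[OF matrix_vector_mul_linear])

text \<open>For an involution \<open>M\<close>, the vectors \<open>v + M v\<close> and
  \<open>v - M v\<close> lie in its eigenspaces for 1 and -1, and they cannot both vanish since they
  add up to \<open>2 v\<close>. This is applied to \<open>B\<close> first and then to
  \<open>A\<close>, which preserves the eigenspaces of \<open>B\<close>.\<close>

lemma commuting_involutions_eigenvector:
  fixes A B :: "complex ^ 'n ^ 'n"
  assumes A: "\<And>v. A *v (A *v v) = v" and B: "\<And>v. B *v (B *v v) = v"
    and comm: "\<And>v. A *v (B *v v) = B *v (A *v v)"
  obtains \<psi> s t where "norm \<psi> = 1" "A *v \<psi> = s *\<^sub>R \<psi>" "B *v \<psi> = t *\<^sub>R \<psi>" "s\<^sup>2 = 1" "t\<^sup>2 = 1"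
proof -
  have step: "\<exists>s :: real. s\<^sup>2 = 1 \<and> v + s *\<^sub>R (M *v v) \<noteq> 0 \<and>
      M *v (v + s *\<^sub>R (M *v v)) = s *\<^sub>R (v + s *\<^sub>R (M *v v))"
    if "v \<noteq> 0" "\<And>v. M *v (M *v v) = v" for v and M :: "complex ^ 'n ^ 'n"
  proof -
    have "v + 1 *\<^sub>R (M *v v) \<noteq> 0 \<or> v + (-1) *\<^sub>R (M *v v) \<noteq> 0"
    proof (rule ccontr)
      assume "\<not> ?thesis"
      then have "v + 1 *\<^sub>R (M *v v) = 0" "v + (-1) *\<^sub>R (M *v v) = 0" by blast+
      then have "(v + 1 *\<^sub>R (M *v v)) + (v + (-1) *\<^sub>R (M *v v)) = 0" by (simp only: add_0)
      moreover have "2 *\<^sub>R v = (v + 1 *\<^sub>R (M *v v)) + (v + (-1) *\<^sub>R (M *v v))"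
        by (simp add: vec_eq_iff scaleR_2)
      ultimately have "2 *\<^sub>R v = 0" by metis
      then show False using that by simp
    qed
    then obtain s :: real where s: "s = 1 \<or> s = -1" "v + s *\<^sub>R (M *v v) \<noteq> 0" by blast
    then have "s * s = 1" by auto
    then have "M *v (v + s *\<^sub>R (M *v v)) = s *\<^sub>R (v + s *\<^sub>R (M *v v))"
      by (simp add: that matrix_vector_right_distrib matrix_vector_mult_complex_scaleR scaleR_add_right add.commute)
    then show ?thesis using s(2) \<open>s * s = 1\<close> by (auto simp: power2_eq_square)
  qed
  obtain t :: real and u where u: "t\<^sup>2 = 1" "u \<noteq> 0" "B *v u = t *\<^sub>R u"
    \<comment> \<open>Any nonzero starting vector would do; this one is an arbitrary coordinate
      vector.\<close>
    using step[of "axis undefined 1" B] B by (auto simp: axis_eq_0_iff)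
  obtain s :: real and w where w: "s\<^sup>2 = 1" "w \<noteq> 0" "A *v w = s *\<^sub>R w" "w = u + s *\<^sub>R (A *v u)"
    using step[of u A] A u(2) by blast
  have "B *v w = t *\<^sub>R w"
    unfolding w(4) by (simp add: u(3) comm[symmetric] matrix_vector_right_distrib matrix_vector_mult_complex_scaleR
        scaleR_add_right mult.commute)
  then show ?thesis
    using that[of "(1 / norm w) *\<^sub>R w" s t] w u(1) by (simp add: matrix_vector_mult_complex_scaleR mult.commute)
qed

lemma eigenvectorI_scaleR:
  assumes "A *v v = s *\<^sub>R v" "norm v = 1"
  shows "eigenvector A v"
proof -
  have "v \<noteq> 0" using assms(2) by auto
  moreover have "A *v v = of_real s *s v"
    unfolding assms(1) by (simp add: vec_eq_iff scaleR_conv_of_real[where 'a = complex])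
  ultimately show ?thesis by (auto simp: eigenvector_def)
qed

lemma expect_scaleR_eigenvector: "A *v \<psi> = s *\<^sub>R \<psi> \<Longrightarrow> norm \<psi> = 1 \<Longrightarrow> expect A \<psi> = s"
  by (simp add: expect_def dot_square_norm)

section \<open>Gamma matrices and their three commuting classes\<close>

text \<open>Separate names instead of an indexed family make the cyclic relabelling of \<open>g0, g1, g2\<close> an
  interpretation of the same locale.\<close>
locale gamma_matrices =
  fixes g0 g1 g2 g3 g4 :: "complex ^ 4 ^ 4"
  assumes herm: "hermitian g0" "hermitian g1" "hermitian g2" "hermitian g3"
    and square: "g0 ** g0 = mat 1" "g1 ** g1 = mat 1" "g2 ** g2 = mat 1" "g3 ** g3 = mat 1"
    and anticomm: "g1 ** g0 = - (g0 ** g1)" "g2 ** g0 = - (g0 ** g2)" "g3 ** g0 = - (g0 ** g3)"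
      "g2 ** g1 = - (g1 ** g2)" "g3 ** g1 = - (g1 ** g3)" "g3 ** g2 = - (g2 ** g3)"
    and g4: "g4 = g0 ** g1 ** g2 ** g3"
begin

lemma square_vector:
  "g0 *v (g0 *v v) = v" "g1 *v (g1 *v v) = v" "g2 *v (g2 *v v) = v" "g3 *v (g3 *v v) = v"
  by (simp_all add: matrix_vector_mul_assoc square)

lemma anticomm_vector:
  "g1 *v (g0 *v v) = - (g0 *v (g1 *v v))" "g2 *v (g0 *v v) = - (g0 *v (g2 *v v))"
  "g3 *v (g0 *v v) = - (g0 *v (g3 *v v))" "g2 *v (g1 *v v) = - (g1 *v (g2 *v v))"
  "g3 *v (g1 *v v) = - (g1 *v (g3 *v v))" "g3 *v (g2 *v v) = - (g2 *v (g3 *v v))"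
  by (simp_all add: matrix_vector_mul_assoc anticomm matrix_vector_mult_minus)

lemma g4_vector: "g4 *v v = g0 *v (g1 *v (g2 *v (g3 *v v)))"
  by (simp add: g4 matrix_vector_mul_assoc matrix_mul_assoc)

text \<open>Operator identities are decided on vectors: nested application keeps neighbouring
  factors adjacent without associativity, \<open>g4\<close> is expanded, and each word is sorted by
  index with its sign while squares cancel.\<close>

lemmas normal_form = matrix_vector_mul_assoc[symmetric] mat_scale_mult_vector vector_scalar_commute
  vector_smult_assoc matrix_vector_mult_minus square_vector anticomm_vector g4_vector
  matrix_vector_mult_add_rdistrib matrix_vector_right_distrib
  matrix_vector_mult_diff_distrib

text \<open>Reversing a product of four anticommuting factors takes six swaps, so the sign is
  positive.\<close>

lemma herm_g4: "hermitian g4"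
  unfolding hermitian_def g4 dagger_mult herm[unfolded hermitian_def] matrix_eq
  by (simp add: normal_form)

lemma hermitian_products:
  "hermitian (mat_scale \<i> (g0 ** g4))" "hermitian (mat_scale \<i> (g1 ** g4))" "hermitian (mat_scale \<i> (g2 ** g4))"
  "hermitian (mat_scale \<i> (g3 ** g0))" "hermitian (mat_scale \<i> (g3 ** g1))" "hermitian (mat_scale \<i> (g3 ** g2))"
  by (intro hermitian_i_mult_anticommuting herm herm_g4; simp add: matrix_eq normal_form)+

text \<open>A 3-cycle is an even permutation, so the product defining \<open>g4\<close> does not
  change. The formulas for the other two classes follow by relabelling.\<close>

lemma cyclic: "gamma_matrices g1 g2 g0 g3 g4"
  by unfold_locales (simp_all add: herm square matrix_eq normal_form)

text \<open>The third operator of the class is the product of the first two, and each of the three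
  is traceless because it anticommutes with \<open>g1\<close> or \<open>g3\<close>.\<close>

lemma collision_probability_class:
  assumes "common_eigenbasis {g0, mat_scale \<i> (g1 ** g4), mat_scale \<i> (g3 ** g2)} B" "norm \<psi> = 1"
  shows "(\<Sum>b\<in>B. cmod (braket b \<psi>) ^ 4)
    = (1 + (expect g0 \<psi>)\<^sup>2 + (expect (mat_scale \<i> (g1 ** g4)) \<psi>)\<^sup>2
         + (expect (mat_scale \<i> (g3 ** g2)) \<psi>)\<^sup>2) / 4"
proof (rule collision_probability_eq_expect[OF assms(1) herm(1) hermitian_products(2,6) square(1)])
  show "trace g0 = 0"
    by (rule trace_anticommuting[of _ g1]) (simp_all add: matrix_eq normal_form)
  show "trace (mat_scale \<i> (g1 ** g4)) = 0"
    by (rule trace_anticommuting[of _ g1]) (simp_all add: matrix_eq normal_form)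
  show "trace (mat_scale \<i> (g3 ** g2)) = 0"
    by (rule trace_anticommuting[of _ g3]) (simp_all add: matrix_eq normal_form)
qed (simp_all add: matrix_eq normal_form assms)

end

section \<open>Expectations at eigenvectors of a unitary\<close>

text \<open>\<open>U\<close> multiplies its eigenvector by a phase only, and a phase cancels in
  expectations.\<close>

lemma expect_unitary_conjugate:
  assumes "unitary U" "eigenvector U \<psi>" "U ** X ** dagger U = Y"
  shows "expect Y \<psi> = expect X \<psi>"
proof -
  obtain c where c: "\<psi> \<noteq> 0" "U *v \<psi> = c *s \<psi>" using assms(2) by (auto simp: eigenvector_def)
  have U: "braket (U *v u) (U *v v) = braket u v" for u v
    using assms(1) by (simp add: braket_dagger matrix_vector_mul_assoc unitary_def)
  have "braket \<psi> \<psi> \<noteq> 0"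
    using c(1) inner_eq_zero_iff[of \<psi>] by (auto simp: inner_eq_Re_braket)
  moreover have "(cnj c * c) * braket \<psi> \<psi> = braket \<psi> \<psi>"
    using U[of \<psi> \<psi>] by (simp add: c(2) braket_smult mult_ac)
  ultimately have c1: "cnj c * c = 1" by simp
  have "Y ** U = U ** X"
    using assms(1,3) by (metis matrix_mul_assoc matrix_mul_rid unitary_def)
  then have "braket (U *v \<psi>) (Y *v (U *v \<psi>)) = braket \<psi> (X *v \<psi>)"
    by (simp add: matrix_vector_mul_assoc) (simp add: U matrix_vector_mul_assoc[symmetric])
  moreover have "braket (U *v \<psi>) (Y *v (U *v \<psi>)) = (cnj c * c) * braket \<psi> (Y *v \<psi>)"
    by (simp add: c(2) braket_smult vector_scalar_commute)
  ultimately show ?thesis by (simp add: c1 expect_def inner_eq_Re_braket)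
qed

lemma conjugate_mat_scale_mult:
  assumes "unitary U" "U ** A ** dagger U = A'" "U ** B ** dagger U = B'"
  shows "U ** mat_scale c (A ** B) ** dagger U = mat_scale c (A' ** B')"
proof -
  have "dagger U *v (U *v v) = v" for v
    using assms(1) by (simp add: matrix_vector_mul_assoc unitary_def)
  then show ?thesis
    unfolding assms(2,3)[symmetric] matrix_eq
    by (simp add: matrix_vector_mul_assoc[symmetric] mat_scale_mult_vector vector_scalar_commute)
qed

theorem mainTheorem5:
  fixes \<Gamma> :: "nat \<Rightarrow> complex ^ 4 ^ 4"
    and B :: "nat \<Rightarrow> (complex ^ 4) set"
    and U :: "complex ^ 4 ^ 4"
  assumes herm: "\<forall>j<4. hermitian (\<Gamma> j)"
    and square: "\<forall>j<4. \<Gamma> j ** \<Gamma> j = mat 1"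
    and anticomm: "\<forall>j<4. \<forall>k<4. j \<noteq> k \<longrightarrow> \<Gamma> j ** \<Gamma> k = - (\<Gamma> k ** \<Gamma> j)"
    and Gamma4: "\<Gamma> 4 = \<Gamma> 0 ** \<Gamma> 1 ** \<Gamma> 2 ** \<Gamma> 3"
    and B0: "common_eigenbasis
      {\<Gamma> 0, mat_scale \<i> (\<Gamma> 1 ** \<Gamma> 4), mat_scale \<i> (\<Gamma> 3 ** \<Gamma> 2)} (B 0)"
    and B1: "common_eigenbasis
      {\<Gamma> 1, mat_scale \<i> (\<Gamma> 2 ** \<Gamma> 4), mat_scale \<i> (\<Gamma> 3 ** \<Gamma> 0)} (B 1)"
    and B2: "common_eigenbasis
      {\<Gamma> 2, mat_scale \<i> (\<Gamma> 0 ** \<Gamma> 4), mat_scale \<i> (\<Gamma> 3 ** \<Gamma> 1)} (B 2)"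
    and U_unitary: "unitary U"
    and U01: "U ** \<Gamma> 0 ** dagger U = \<Gamma> 1"
    and U12: "U ** \<Gamma> 1 ** dagger U = \<Gamma> 2"
    and U20: "U ** \<Gamma> 2 ** dagger U = \<Gamma> 0"
    and U33: "U ** \<Gamma> 3 ** dagger U = \<Gamma> 3"
    and U44: "U ** \<Gamma> 4 ** dagger U = \<Gamma> 4"
  shows "(\<exists>\<psi>. is_arg_min (\<lambda>\<phi>. 1 / 3 * (\<Sum>j=0..2. collision_entropy (B j) \<phi>)) (\<lambda>\<phi>. norm \<phi> = 1) \<psi>
           \<and> eigenvector (\<Gamma> 0) \<psi>
           \<and> eigenvector (mat_scale \<i> (\<Gamma> 2 ** \<Gamma> 4)) \<psi>
           \<and> eigenvector (mat_scale \<i> (\<Gamma> 3 ** \<Gamma> 1)) \<psi>)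
       \<and> (\<forall>\<psi>. eigenvector U \<psi> \<longrightarrow>
           \<not> is_arg_min (\<lambda>\<phi>. 1 / 3 * (\<Sum>j=0..2. collision_entropy (B j) \<phi>)) (\<lambda>\<phi>. norm \<phi> = 1) \<psi>)"
proof -
  \<comment> \<open>otherwise \<open>\<Gamma> 1\<close> is rewritten to \<open>\<Gamma> (Suc 0)\<close>, which the instantiated locale facts do not match\<close>
  note One_nat_def [simp del]
  interpret G: gamma_matrices "\<Gamma> 0" "\<Gamma> 1" "\<Gamma> 2" "\<Gamma> 3" "\<Gamma> 4"
    by unfold_locales (fact Gamma4 | (rule herm[rule_format] square[rule_format] anticomm[rule_format]; simp))+
  interpret G': gamma_matrices "\<Gamma> 1" "\<Gamma> 2" "\<Gamma> 0" "\<Gamma> 3" "\<Gamma> 4"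
    by (rule G.cyclic)
  interpret G'': gamma_matrices "\<Gamma> 2" "\<Gamma> 0" "\<Gamma> 1" "\<Gamma> 3" "\<Gamma> 4"
    by (rule G'.cyclic)
  \<comment> \<open>In the array whose columns are the three classes, each row is an anticommuting
    triple.\<close>
  have rows: "(expect (\<Gamma> 0) \<phi>)\<^sup>2 + (expect (\<Gamma> 1) \<phi>)\<^sup>2 + (expect (\<Gamma> 2) \<phi>)\<^sup>2 \<le> 1"
    "(expect (mat_scale \<i> (\<Gamma> 1 ** \<Gamma> 4)) \<phi>)\<^sup>2 + (expect (mat_scale \<i> (\<Gamma> 2 ** \<Gamma> 4)) \<phi>)\<^sup>2
      + (expect (mat_scale \<i> (\<Gamma> 0 ** \<Gamma> 4)) \<phi>)\<^sup>2 \<le> 1"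
    "(expect (mat_scale \<i> (\<Gamma> 3 ** \<Gamma> 2)) \<phi>)\<^sup>2 + (expect (mat_scale \<i> (\<Gamma> 3 ** \<Gamma> 0)) \<phi>)\<^sup>2
      + (expect (mat_scale \<i> (\<Gamma> 3 ** \<Gamma> 1)) \<phi>)\<^sup>2 \<le> 1" if "norm \<phi> = 1" for \<phi>
    by (rule expect_anticommuting_triple; simp add: G.herm G.hermitian_products that G.normal_form)+
  \<comment> \<open>With \<open>S = \<Gamma> 0 + \<Gamma> 1 + \<Gamma> 2\<close> the row sums are
    \<open>S\<close>, \<open>i S \<Gamma> 4\<close> and \<open>i \<Gamma> 3 S\<close>. Since
    \<open>S\<close> squares to 3 and anticommutes with \<open>\<Gamma> 3\<close> and
    \<open>\<Gamma> 4\<close>, which also anticommute, they form a triple with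
    \<open>k = 3\<close>.\<close>
  have row_sums: "(expect (\<Gamma> 0 + \<Gamma> 1 + \<Gamma> 2) \<phi>)\<^sup>2
      + (expect (mat_scale \<i> (\<Gamma> 1 ** \<Gamma> 4) + mat_scale \<i> (\<Gamma> 2 ** \<Gamma> 4) + mat_scale \<i> (\<Gamma> 0 ** \<Gamma> 4)) \<phi>)\<^sup>2
      + (expect (mat_scale \<i> (\<Gamma> 3 ** \<Gamma> 2) + mat_scale \<i> (\<Gamma> 3 ** \<Gamma> 0) + mat_scale \<i> (\<Gamma> 3 ** \<Gamma> 1)) \<phi>)\<^sup>2 \<le> 3"
    if "norm \<phi> = 1" for \<phi>
    by (rule expect_anticommuting_triple;
        (intro hermitian_add G.herm G.hermitian_products that)?;
        simp add: G.normal_form scaleR_conv_of_real vec_eq_iff)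
  define p where "p j \<phi> = (\<Sum>b\<in>B j. cmod (braket b \<phi>) ^ 4)" for j \<phi>
  define f where "f \<phi> = 1 / 3 * (\<Sum>j=0..2. collision_entropy (B j) \<phi>)" for \<phi>
  note p = G.collision_probability_class[OF B0, folded p_def] G'.collision_probability_class[OF B1, folded p_def]
    G''.collision_probability_class[OF B2, folded p_def]
  have p_sum: "4 * (p 0 \<phi> + p 1 \<phi> + p 2 \<phi>) = 3
      + ((expect (\<Gamma> 0) \<phi>)\<^sup>2 + (expect (\<Gamma> 1) \<phi>)\<^sup>2 + (expect (\<Gamma> 2) \<phi>)\<^sup>2)
      + ((expect (mat_scale \<i> (\<Gamma> 1 ** \<Gamma> 4)) \<phi>)\<^sup>2 + (expect (mat_scale \<i> (\<Gamma> 2 ** \<Gamma> 4)) \<phi>)\<^sup>2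
        + (expect (mat_scale \<i> (\<Gamma> 0 ** \<Gamma> 4)) \<phi>)\<^sup>2)
      + ((expect (mat_scale \<i> (\<Gamma> 3 ** \<Gamma> 2)) \<phi>)\<^sup>2 + (expect (mat_scale \<i> (\<Gamma> 3 ** \<Gamma> 0)) \<phi>)\<^sup>2
        + (expect (mat_scale \<i> (\<Gamma> 3 ** \<Gamma> 1)) \<phi>)\<^sup>2)" if "norm \<phi> = 1" for \<phi>
    unfolding p[OF that] by (simp add: field_simps)
  have idx: "{0..2::nat} = {0, 1, 2}" by auto
  \<comment> \<open>One bound serves both claims: a probability sum of at most 3/2 gives entropy at
    least 1, and a strictly smaller sum gives a strict inequality.\<close>
  have f_ge: "f \<phi> \<ge> 1 - (2 * (p 0 \<phi> + p 1 \<phi> + p 2 \<phi>) - 3) / (3 * ln 2)" if "norm \<phi> = 1" for \<phi>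
  proof -
    have "p j \<phi> > 0" if "j \<in> {0..2}" for j
      using that unfolding idx by (auto simp: p[OF \<open>norm \<phi> = 1\<close>] intro!: add_pos_nonneg)
    then have "(\<Sum>j=0..2. - log 2 (p j \<phi>)) \<ge> card {0..2::nat} - (2 * (\<Sum>j=0..2. p j \<phi>) - card {0..2::nat}) / ln 2"
      by (rule sum_neg_log_ge)
    then show ?thesis
      unfolding f_def collision_entropy_def p_def[symmetric] idx by (simp add: field_simps)
  qed
  \<comment> \<open>Two of the operators suffice here: the third is minus their product, which fixes
    its eigenvalue as \<open>- (s * t)\<close>.\<close>
  obtain \<psi> s t where \<psi>n: "norm \<psi> = 1" "\<Gamma> 0 *v \<psi> = s *\<^sub>R \<psi>" "mat_scale \<i> (\<Gamma> 2 ** \<Gamma> 4) *v \<psi> = t *\<^sub>R \<psi>"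
      "s\<^sup>2 = 1" "t\<^sup>2 = 1"
    by (rule commuting_involutions_eigenvector[of "\<Gamma> 0" "mat_scale \<i> (\<Gamma> 2 ** \<Gamma> 4)"]) (simp_all add: G.normal_form)
  have "mat_scale \<i> (\<Gamma> 3 ** \<Gamma> 1) *v \<psi> = - (\<Gamma> 0 *v (mat_scale \<i> (\<Gamma> 2 ** \<Gamma> 4) *v \<psi>))"
    by (simp add: G.normal_form)
  also have "\<dots> = (- (s * t)) *\<^sub>R \<psi>"
    by (simp add: \<psi>n matrix_vector_mult_complex_scaleR mult.commute)
  finally have "mat_scale \<i> (\<Gamma> 3 ** \<Gamma> 1) *v \<psi> = (- (s * t)) *\<^sub>R \<psi>" .
  note eig = \<psi>n(2,3) this
  note \<psi> = \<psi>n(1) eig[THEN eigenvectorI_scaleR, OF \<psi>n(1)]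
  have exp: "(expect (\<Gamma> 0) \<psi>)\<^sup>2 = 1" "(expect (mat_scale \<i> (\<Gamma> 2 ** \<Gamma> 4)) \<psi>)\<^sup>2 = 1"
      "(expect (mat_scale \<i> (\<Gamma> 3 ** \<Gamma> 1)) \<psi>)\<^sup>2 = 1"
    using \<psi>n(4,5) eig[THEN expect_scaleR_eigenvector, OF \<psi>n(1)] by (simp_all add: power_mult_distrib)
  have f\<psi>: "f \<psi> \<le> 1"
  proof -
    have "- log 2 (p j \<psi>) \<le> 1" if "j \<in> {0..2}" for j
    proof -
      \<comment> \<open>Each class contains exactly one of the three operators, so one of its
        squares is 1 and \<open>p j \<psi>\<close> is at least \<open>(1 + 1) / 4\<close>.\<close>
      have "p j \<psi> \<ge> 1 / 2"
        using that unfolding idx by (auto simp: p[OF \<psi>(1)] exp)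
      then have "log 2 (p j \<psi>) \<ge> log 2 (1 / 2)" by (subst log_le_cancel_iff) auto
      then show ?thesis by (simp add: log_divide)
    qed
    then have "(\<Sum>j=0..2. - log 2 (p j \<psi>)) \<le> (\<Sum>j=0..2::nat. 1)" by (rule sum_mono)
    then show ?thesis unfolding f_def collision_entropy_def p_def[symmetric] by simp
  qed
  have f_ge1: "f \<phi> \<ge> 1" if "norm \<phi> = 1" for \<phi>
  proof -
    have "2 * (p 0 \<phi> + p 1 \<phi> + p 2 \<phi>) - 3 \<le> 0"
      using rows[OF that] p_sum[OF that] by linarith
    then have "(2 * (p 0 \<phi> + p 1 \<phi> + p 2 \<phi>) - 3) / (3 * ln 2) \<le> 0" by (simp add: divide_nonpos_pos)
    then show ?thesis using f_ge[OF that] by linarith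
  qed
  have f_gt1: "f \<phi> > 1" if n: "norm \<phi> = 1" and ev: "eigenvector U \<phi>" for \<phi>
  proof -
    note conj = conjugate_mat_scale_mult[OF U_unitary]
    note inv = expect_unitary_conjugate[OF U_unitary ev]
    have e0: "expect (\<Gamma> 1) \<phi> = expect (\<Gamma> 0) \<phi>" "expect (\<Gamma> 2) \<phi> = expect (\<Gamma> 0) \<phi>"
      using inv[OF U01] inv[OF U12] by simp_all
    have e1: "expect (mat_scale \<i> (\<Gamma> 2 ** \<Gamma> 4)) \<phi> = expect (mat_scale \<i> (\<Gamma> 1 ** \<Gamma> 4)) \<phi>"
      "expect (mat_scale \<i> (\<Gamma> 0 ** \<Gamma> 4)) \<phi> = expect (mat_scale \<i> (\<Gamma> 1 ** \<Gamma> 4)) \<phi>"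
      using inv[OF conj[OF U12 U44]] inv[OF conj[OF U20 U44]] by simp_all
    have e2: "expect (mat_scale \<i> (\<Gamma> 3 ** \<Gamma> 0)) \<phi> = expect (mat_scale \<i> (\<Gamma> 3 ** \<Gamma> 2)) \<phi>"
      "expect (mat_scale \<i> (\<Gamma> 3 ** \<Gamma> 1)) \<phi> = expect (mat_scale \<i> (\<Gamma> 3 ** \<Gamma> 2)) \<phi>"
      using inv[OF conj[OF U33 U20]] inv[OF conj[OF U33 U01]] by simp_all
    \<comment> \<open>The row sums have three times the common expectation of their row, so the
      squares of these three common values add up to at most 1/3. The nine squares then total at
      most 1, and the probabilities sum to at most 1, below 3/2.\<close>
    have "2 * (p 0 \<phi> + p 1 \<phi> + p 2 \<phi>) - 3 < 0"
      using row_sums[OF n] p_sum[OF n] unfolding expect_add e0 e1 e2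
      by (simp add: power_mult_distrib)
    then have "(2 * (p 0 \<phi> + p 1 \<phi> + p 2 \<phi>) - 3) / (3 * ln 2) < 0" by (simp add: divide_neg_pos)
    then show ?thesis using f_ge[OF n] by linarith
  qed
  have "is_arg_min f (\<lambda>\<phi>. norm \<phi> = 1) \<psi>"
    using f\<psi> f_ge1 \<psi>(1) by (force simp: is_arg_min_def)
  moreover have "\<not> is_arg_min f (\<lambda>\<phi>. norm \<phi> = 1) \<phi>" if "eigenvector U \<phi>" for \<phi>
    using f\<psi> f_gt1[OF _ that] \<psi>(1) by (force simp: is_arg_min_def)
  ultimately show ?thesis
    unfolding f_def using \<psi> by blast
qed

end
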